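(* Let $3\le r\le 8$ and $1\le a\le r$. The set $L_r^a$ of skew $a$-lines in $Pic\,S_r$ is bijective to the set of $(a-1)$-simplexes in the Gosset polytope $(r-4)_{21}$.
   Context: $S_r$ is a del Pezzo surface obtained by blowing up $\mathbb{P}^2$ at $r$ points in general position. $Pic\,S_r=\mathbb{Z}h\oplus\mathbb{Z}e_1\oplus\dots\oplus\mathbb{Z}e_r$ with $h^2=1$, $h\cdot e_i=0$, $e_i\cdot e_j=-\delta_{ij}$, and $K_{S_r}=-3h+\sum_{i=1}^r e_i$. The set of lines is $L_r=\{l\in Pic\,S_r\mid l^2=l\cdot K_{S_r}=-1\}$. Distinct lines $l,l'$ are disjoint (skew) if $l\cdot l'=0$. The set of skew $a$-lines is $$L_r^a=\{D\in Pic\,S_r\mid D=l_1+\dots+l_a,\ l_1,\dots,l_a\in L_r \text{ pairwise disjoint distinct lines}\}.$$ The Gosset polytope $(r-4)_{21}$ is the $r$-dimensional semiregular polytope with symmetry group the Coxeter group $E_r$ ($E_3=A_1\times A_2$, $E_4=A_4$, $E_5=D_5$); it is realized as the convex hull of $L_r$ in the affine hyperplane $\tilde H_1=\{D\in Pic\,S_r\otimes\mathbb{Q}\mid -D\cdot K_{S_r}=1\}$, with the Euclidean metric given by minus the intersection form, and its vertices are exactly the elements of $L_r$. A $k$-simplex in $(r-4)_{21}$ is a $k$-dimensional face that is a regular simplex (vertices are the $0$-simplexes); every proper face is a simplex except for the facets that are $(r-1)$-crosspolytopes. *)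

theory Defs
  imports "HOL-Analysis.Analysis"
begin

text \<open>
  The blown-up points are indexed by a finite type \<open>'n\<close>, so that \<open>r = CARD('n)\<close>.
  The pair \<open>(d, m)\<close> stands for the class \<open>d h + (\<Sum>i. m\<^sub>i e\<^sub>i)\<close>; with integer entries these
  form the Picard group of the surface, with real entries its extension of scalars to the reals.
\<close>

type_synonym ('a, 'n) cls = "'a \<times> ('a, 'n) vec"
type_synonym 'n pic = "(int, 'n) cls"
type_synonym 'n pic_real = "(real, 'n) cls"

definition hyp :: "('a::comm_ring_1, 'n::finite) cls"
  where "hyp = (1, 0)"

definition exc :: "'n \<Rightarrow> ('a::comm_ring_1, 'n::finite) cls"
  where "exc i = (0, axis i 1)"

definition canonical :: "('a::comm_ring_1, 'n::finite) cls"
  where "canonical = (\<Sum>i\<in>UNIV. exc i) - (hyp + hyp + hyp)"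

definition isect :: "('a::comm_ring_1, 'n::finite) cls \<Rightarrow> ('a, 'n) cls \<Rightarrow> 'a"  (infixl "\<cdot>" 70)
  where "D \<cdot> E = fst D * fst E - (\<Sum>i\<in>UNIV. snd D $ i * snd E $ i)"

lemma isect_hyp_hyp: "hyp \<cdot> hyp = 1"
  by (simp add: isect_def hyp_def)

lemma isect_hyp_exc: "hyp \<cdot> exc i = 0"
  by (simp add: isect_def hyp_def exc_def)

lemma isect_exc_exc:
  "exc i \<cdot> exc j = (if i = j then - 1 else (0::'a::comm_ring_1))"
proof -
  have "(\<Sum>k\<in>UNIV. axis i (1::'a) $ k * axis j 1 $ k) = (\<Sum>k\<in>UNIV. if k = i then axis j 1 $ k else 0)"
    by (rule sum.cong) (auto simp: axis_def)
  then show ?thesis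
    by (simp add: isect_def exc_def) (simp add: axis_def)
qed

lemma canonical_eq: "canonical = (- 3, \<chi> i. 1)"
  by (auto simp: canonical_def hyp_def exc_def fst_sum snd_sum prod_eq_iff vec_eq_iff
      axis_def)

definition lines :: "'n::finite pic set"
  where "lines = {l. l \<cdot> l = - 1 \<and> l \<cdot> canonical = - 1}"

definition skew_lines :: "nat \<Rightarrow> 'n::finite pic set"
  where "skew_lines a = {\<Sum>S |S. S \<subseteq> lines \<and> finite S \<and> card S = a \<and> pairwise (\<lambda>l l'. l \<cdot> l' = 0) S}"

definition to_real :: "'n::finite pic \<Rightarrow> 'n pic_real"
  where "to_real D = (of_int (fst D), \<chi> i. of_int (snd D $ i))"

definition gosset :: "'n::finite pic_real set"
  where "gosset = convex hull (to_real ` lines)"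

text \<open>
  On the affine hyperplane \<open>- D \<cdot> K = 1\<close> this is the Euclidean distance belonging to minus the
  intersection form when \<open>r \<le> 8\<close>. It is not the \<open>dist\<close> of the product type, which on this
  hyperplane has different regular simplices; faces, convex hulls and affine independence do not
  depend on the choice of metric.
\<close>

definition pic_dist :: "'n::finite pic_real \<Rightarrow> 'n pic_real \<Rightarrow> real"
  where "pic_dist x y = sqrt (- ((x - y) \<cdot> (x - y)))"

definition regular_simplex :: "nat \<Rightarrow> 'n::finite pic_real set \<Rightarrow> bool"
  where "regular_simplex k F \<longleftrightarrow>
    int k simplex F \<and> (\<exists>s. pairwise (\<lambda>v w. pic_dist v w = s) {v. v extreme_point_of F})"

definition gosset_simplexes :: "nat \<Rightarrow> 'n::finite pic_real set set"
  where "gosset_simplexes k = {F. F face_of gosset \<and> regular_simplex k F}"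

lemma isect_to_real: "to_real D \<cdot> to_real E = of_int (D \<cdot> E)"
  by (simp add: to_real_def isect_def)

lemma gosset_subset_hyperplane: "gosset \<subseteq> {D. - (D \<cdot> canonical) = 1}"
  unfolding gosset_def
proof (rule hull_minimal)
  have "to_real canonical = (canonical :: 'a pic_real)"
    by (simp add: to_real_def canonical_eq)
  then have "to_real l \<cdot> canonical = of_int (l \<cdot> canonical)" for l :: "'a pic"
    by (metis isect_to_real)
  then show "to_real ` lines \<subseteq> {D :: 'a pic_real. - (D \<cdot> canonical) = 1}"
    by (auto simp: lines_def)
  show "convex {D :: 'a pic_real. - (D \<cdot> canonical) = 1}"
  proof (rule convexI)
    fix x y :: "'a pic_real" and u v :: real
    assume x: "x \<in> {D. - (D \<cdot> canonical) = 1}" and y: "y \<in> {D. - (D \<cdot> canonical) = 1}"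
      and uv: "u + v = 1"
    have "(u *\<^sub>R x + v *\<^sub>R y) \<cdot> canonical = u * (x \<cdot> canonical) + v * (y \<cdot> canonical)"
      by (simp add: isect_def algebra_simps sum.distrib sum_distrib_left)
    also have "\<dots> = - (u + v)"
      using x y by (simp add: minus_equation_iff[of _ 1])
    finally show "u *\<^sub>R x + v *\<^sub>R y \<in> {D. - (D \<cdot> canonical) = 1}"
      using uv by simp
  qed
qed

end

theory Submission
  imports Defs
begin

text \<open>
  Both sides are parametrized by the sets \<open>S\<close> of \<open>a\<close> pairwise skew lines: such a set gives the
  skew \<open>a\<close>-line \<open>\<Sum>S\<close> on one side and the convex hull of \<open>S\<close> on the other.

  All positivity comes from the Hodge index theorem: for \<open>r \<le> 8\<close> the form is negative definite on
  the orthogonal complement of \<open>K\<close>, whence two distinct lines meet non-negatively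
  (\<open>distinct_lines_isect_nonneg\<close>). Therefore \<open>S\<close> can be read off from \<open>D = \<Sum>S\<close>, as the set of
  lines \<open>l\<close> with \<open>D \<cdot> l < 0\<close>. The class \<open>D - K\<close>, the pullback of the anticanonical class under
  the contraction of \<open>S\<close>, vanishes on the members of \<open>S\<close> and is positive on all other lines, so the
  hull of \<open>S\<close> is a face (\<open>skew_set_face\<close>). It is a simplex because pairwise orthogonal classes of
  square \<open>-1\<close> are linearly independent, and it is regular because all its edges have length
  \<open>\<surd>2\<close>.

  Conversely, the vertices of a face that is a simplex are lines, any two of which span an edge of
  the polytope, and it has to be shown that two lines spanning an edge are skew
  (\<open>edge_imp_skew\<close>). If \<open>l \<cdot> l' \<ge> 1\<close>, then \<open>D = l + l'\<close> is a nef class of anticanonical degree 2.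
  Up to a permutation of the \<open>e\<^sub>i\<close>, Cremona reflections bring such a class to one of \<open>h - e\<^sub>1\<close>,
  \<open>3 h - e\<^sub>1 - \<dots> - e\<^sub>7\<close> and, for \<open>r = 8\<close>, \<open>- 2 K\<close>; each of these is a sum of two lines in several ways
  (\<open>nef_degree_two_splits\<close>). So the segment from \<open>l\<close> to \<open>l'\<close> shares its midpoint with the segment
  between two other vertices, and it is not a face. This is where \<open>r \<ge> 3\<close> enters: for \<open>r = 2\<close> the
  polytope is a triangle, two of whose edges join lines that are not skew.
\<close>

section \<open>The intersection form\<close>

lemma isect_commute: "D \<cdot> E = E \<cdot> D"
  by (simp add: isect_def mult.commute)

lemma isect_add_left: "(D + E) \<cdot> F = D \<cdot> F + E \<cdot> F"
  by (simp add: isect_def algebra_simps sum.distrib)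

lemma isect_diff_left: "(D - E) \<cdot> F = D \<cdot> F - E \<cdot> F"
  by (simp add: isect_def algebra_simps sum_subtractf)

lemma isect_add_right: "F \<cdot> (D + E) = F \<cdot> D + F \<cdot> E"
  by (simp add: isect_commute[of F] isect_add_left)

lemma isect_diff_right: "F \<cdot> (D - E) = F \<cdot> D - F \<cdot> E"
  by (simp add: isect_commute[of F] isect_diff_left)

lemma isect_zero_left [simp]: "0 \<cdot> F = 0"
  by (simp add: isect_def)

lemma isect_sum_left: "(\<Sum>x\<in>A. f x) \<cdot> F = (\<Sum>x\<in>A. f x \<cdot> F)"
  by (induction A rule: infinite_finite_induct) (simp_all add: isect_add_left)

lemma isect_scaleR_left: "(u *\<^sub>R D) \<cdot> F = u * (D \<cdot> F)"
  for D :: "'n::finite pic_real"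
  by (simp add: isect_def algebra_simps sum_distrib_left)

lemmas isect_bilinear =
  isect_add_left isect_diff_left isect_add_right isect_diff_right

lemma isect_exc_right: "D \<cdot> exc i = - snd D $ i"
  by (simp add: isect_def exc_def axis_def if_distrib cong: if_cong)

lemma isect_hyp_right: "D \<cdot> hyp = fst D"
  by (simp add: isect_def hyp_def)

lemma isect_canonical: "D \<cdot> canonical = - 3 * fst D - (\<Sum>i\<in>UNIV. snd D $ i)"
  by (simp add: isect_def canonical_eq)

lemma isect_as_inner: "M \<cdot> x = (fst M, - snd M) \<bullet> x"
  for M x :: "'n::finite pic_real"
  by (simp add: isect_def inner_prod_def inner_vec_def sum_negf)

lemma to_real_add: "to_real (D + E) = to_real D + to_real E"
  by (simp add: to_real_def vec_eq_iff)

lemma inj_to_real: "inj to_real"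
  by (auto simp: inj_def to_real_def prod_eq_iff vec_eq_iff)

text \<open>
  The signature of the form on the complement of \<open>K\<close>, made explicit: for \<open>r \<le> 8\<close> the right-hand
  side is minus a non-negative combination of squares. The relation \<open>\<Sum>m\<^sub>i = - 3 d\<close> turns the cross term of
  \<open>\<Sum>(3 m\<^sub>i + d)\<^sup>2\<close> into a multiple of \<open>d\<^sup>2\<close>.
\<close>

lemma hodge_identity:
  fixes D :: "'n::finite pic"
  assumes "D \<cdot> canonical = 0"
  shows "9 * (D \<cdot> D) =
    - ((9 - int CARD('n)) * (fst D)\<^sup>2) - (\<Sum>i\<in>UNIV. (3 * snd D $ i + fst D)\<^sup>2)"
proof -
  have m: "(\<Sum>i\<in>UNIV. snd D $ i) = - 3 * fst D"
    using assms by (simp add: isect_canonical)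
  have "(\<Sum>i\<in>UNIV. (3 * snd D $ i + fst D)\<^sup>2) =
      9 * (\<Sum>i\<in>UNIV. snd D $ i * snd D $ i) + 6 * fst D * (\<Sum>i\<in>UNIV. snd D $ i)
      + int CARD('n) * (fst D)\<^sup>2"
    by (simp add: power2_eq_square algebra_simps sum.distrib sum_distrib_left)
  then show ?thesis
    unfolding m by (simp add: isect_def power2_eq_square algebra_simps)
qed

lemma hodge_index:
  fixes D :: "'n::finite pic"
  assumes "CARD('n) \<le> 8" and K: "D \<cdot> canonical = 0" and "D \<noteq> 0"
  shows "D \<cdot> D < 0"
proof (rule ccontr)
  assume "\<not> D \<cdot> D < 0"
  moreover have "(fst D)\<^sup>2 \<le> (9 - int CARD('n)) * (fst D)\<^sup>2"
    using assms(1) mult_right_mono[of 1 "9 - int CARD('n)" "(fst D)\<^sup>2"] by simp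
  moreover have s: "0 \<le> (\<Sum>i\<in>UNIV. (3 * snd D $ i + fst D)\<^sup>2)"
    by (simp add: sum_nonneg)
  ultimately have "(fst D)\<^sup>2 \<le> 0" "(\<Sum>i\<in>UNIV. (3 * snd D $ i + fst D)\<^sup>2) \<le> 0"
    using hodge_identity[OF K] zero_le_power2[of "fst D"] by linarith+
  then have "fst D = 0" "\<forall>i. 3 * snd D $ i + fst D = 0"
    using s by (simp_all add: sum_nonneg_eq_0_iff order_antisym_conv)
  then have "D = 0"
    by (simp add: prod_eq_iff vec_eq_iff)
  with \<open>D \<noteq> 0\<close> show False ..
qed

section \<open>Lines\<close>

lemma line_square: "l \<in> lines \<Longrightarrow> l \<cdot> l = - 1"
  by (simp add: lines_def)

lemma line_degree: "l \<in> lines \<Longrightarrow> l \<cdot> canonical = - 1"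
  by (simp add: lines_def)

text \<open>
  The difference of two lines is orthogonal to \<open>K\<close> and has square \<open>- 2 - 2 (l \<cdot> l')\<close>, which is
  negative by the Hodge index theorem.
\<close>

lemma distinct_lines_isect_nonneg:
  fixes l l' :: "'n::finite pic"
  assumes "CARD('n) \<le> 8" "l \<in> lines" "l' \<in> lines" "l \<noteq> l'"
  shows "0 \<le> l \<cdot> l'"
proof -
  have "(l - l') \<cdot> (l - l') < 0"
    using assms by (intro hodge_index) (simp_all add: isect_diff_left line_degree)
  then show ?thesis
    using assms by (simp add: isect_bilinear line_square isect_commute[of l' l])
qed

lemma exc_line: "exc i \<in> lines"
  by (simp add: lines_def isect_canonical isect_exc_exc)
    (simp add: exc_def axis_def)

lemma secant_line:
  assumes "i \<noteq> j"
  shows "hyp - exc i - exc j \<in> lines"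
  using assms
  by (simp add: lines_def isect_bilinear isect_exc_exc isect_hyp_hyp isect_hyp_exc
      isect_commute[of "exc _" hyp] line_degree[OF exc_line])
    (simp add: isect_canonical hyp_def)

section \<open>Cremona reflections\<close>

text \<open>
  The map \<open>D \<mapsto> D + (D \<cdot> \<alpha>) \<alpha>\<close>. For \<open>\<alpha> = h - e\<^sub>i - e\<^sub>j - e\<^sub>k\<close> it is the action on the Picard group
  of the quadratic Cremona transformation centred at three of the blown-up points.
\<close>

definition reflect :: "'n::finite pic \<Rightarrow> 'n pic \<Rightarrow> 'n pic"
  where "reflect \<alpha> D = (fst D + (D \<cdot> \<alpha>) * fst \<alpha>, \<chi> i. snd D $ i + (D \<cdot> \<alpha>) * snd \<alpha> $ i)"

lemma isect_reflect_left: "reflect \<alpha> D \<cdot> E = D \<cdot> E + (D \<cdot> \<alpha>) * (\<alpha> \<cdot> E)"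
proof -
  define k where "k = D \<cdot> \<alpha>"
  have "reflect \<alpha> D \<cdot> E = D \<cdot> E + k * (\<alpha> \<cdot> E)"
    unfolding reflect_def k_def[symmetric]
    by (simp add: isect_def algebra_simps sum.distrib sum_distrib_left)
  then show ?thesis
    by (simp add: k_def)
qed

lemma reflect_diff: "reflect \<alpha> (D - E) = reflect \<alpha> D - reflect \<alpha> E"
  by (simp add: reflect_def isect_diff_left vec_eq_iff algebra_simps)

definition is_root :: "'n::finite pic \<Rightarrow> bool"
  where "is_root \<alpha> \<longleftrightarrow> \<alpha> \<cdot> \<alpha> = - 2 \<and> \<alpha> \<cdot> canonical = 0"

text \<open>
  With the involution property below, self-adjointness makes a reflection an isometry, which
  therefore permutes the lines.
\<close>

lemma isect_reflect_adjoint: "reflect \<alpha> D \<cdot> E = D \<cdot> reflect \<alpha> E"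
proof -
  have "reflect \<alpha> D \<cdot> E = D \<cdot> E + (D \<cdot> \<alpha>) * (\<alpha> \<cdot> E)"
    by (rule isect_reflect_left)
  also have "\<dots> = E \<cdot> D + (E \<cdot> \<alpha>) * (\<alpha> \<cdot> D)"
    by (metis isect_commute mult.commute)
  also have "\<dots> = D \<cdot> reflect \<alpha> E"
    by (metis isect_reflect_left isect_commute)
  finally show ?thesis .
qed

lemma reflect_reflect:
  assumes "is_root \<alpha>"
  shows "reflect \<alpha> (reflect \<alpha> D) = D"
proof -
  have "reflect \<alpha> D \<cdot> \<alpha> = - (D \<cdot> \<alpha>)"
    using assms by (simp add: isect_reflect_left is_root_def)
  then show ?thesis
    by (simp add: reflect_def[of \<alpha> "reflect \<alpha> D"]) (simp add: reflect_def prod_eq_iff vec_eq_iff)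
qed

lemma isect_reflect_reflect: "is_root \<alpha> \<Longrightarrow> reflect \<alpha> D \<cdot> reflect \<alpha> E = D \<cdot> E"
  by (simp add: isect_reflect_adjoint reflect_reflect)

lemma reflect_degree: "is_root \<alpha> \<Longrightarrow> reflect \<alpha> D \<cdot> canonical = D \<cdot> canonical"
  by (simp add: isect_reflect_left is_root_def)

lemma reflect_line: "is_root \<alpha> \<Longrightarrow> l \<in> lines \<Longrightarrow> reflect \<alpha> l \<in> lines"
  by (simp add: lines_def isect_reflect_reflect reflect_degree)

lemma cremona_root:
  fixes i j k :: "'n::finite"
  assumes "i \<noteq> j" "i \<noteq> k" "j \<noteq> k"
  shows "is_root (hyp - exc i - exc j - exc k)"
proof -
  have "(hyp :: 'n pic) \<cdot> canonical = - 3"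
    by (simp add: isect_canonical hyp_def)
  then show ?thesis
    using assms
    by (simp add: is_root_def isect_bilinear isect_exc_exc isect_hyp_hyp isect_hyp_exc
        isect_commute[of "exc _" hyp] line_degree[OF exc_line])
qed

section \<open>Nef classes of degree two\<close>

definition nef :: "'n::finite pic \<Rightarrow> bool"
  where "nef D \<longleftrightarrow> (\<forall>l\<in>lines. 0 \<le> D \<cdot> l)"

lemma nef_reflect: "is_root \<alpha> \<Longrightarrow> nef D \<Longrightarrow> nef (reflect \<alpha> D)"
  by (simp add: nef_def isect_reflect_adjoint reflect_line)

lemma ex_maximizer:
  fixes c :: "'a \<Rightarrow> int"
  assumes "finite A" "A \<noteq> {}"
  obtains i where "i \<in> A" "\<And>j. j \<in> A \<Longrightarrow> c j \<le> c i"
proof -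
  have "Max (c ` A) \<in> c ` A"
    using assms by simp
  then obtain i where "i \<in> A" "Max (c ` A) = c i"
    by auto
  then show thesis
    using that[of i] Max_ge[of "c ` A"] assms by simp
qed

text \<open>
  Here \<open>d h - \<Sum>c\<^sub>i e\<^sub>i\<close> is a class of anticanonical degree 2 whose coefficient \<open>d\<close> is not lowered by
  any Cremona reflection. With the largest coefficients \<open>c\<^sub>p \<ge> c\<^sub>q \<ge> c\<^sub>s\<close>, the degree condition and
  \<open>r \<le> 8\<close> give
  \<open>c\<^sub>s + 2 (c\<^sub>p - c\<^sub>s) + 2 (c\<^sub>q - c\<^sub>s) + 3 (d - c\<^sub>p - c\<^sub>q - c\<^sub>s) \<le> 2\<close>, a bound on a sum of
  non-negative terms. Its solutions are \<open>h - e\<^sub>p\<close> for \<open>c\<^sub>s = 0\<close>, \<open>3 h\<close> minus seven exceptional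
  classes for \<open>c\<^sub>s = 1\<close>, and \<open>6 h - 2 (e\<^sub>1 + \<dots> + e\<^sub>8)\<close> for \<open>c\<^sub>s = 2\<close>. In each case two indices
  satisfy \<open>D\<^sup>2 = 2 c\<^sub>i\<close>, which is the condition for \<open>D - e\<^sub>i\<close> to be a line.
\<close>

lemma reduced_degree_two:
  fixes c :: "'n::finite \<Rightarrow> int" and d :: int
  assumes card: "3 \<le> CARD('n)" "CARD('n) \<le> 8"
    and nonneg: "\<And>i. 0 \<le> c i"
    and reduced: "\<And>i j k. i \<noteq> j \<Longrightarrow> i \<noteq> k \<Longrightarrow> j \<noteq> k \<Longrightarrow> c i + c j + c k \<le> d"
    and degree: "3 * d - (\<Sum>i\<in>UNIV. c i) = 2"
  shows "\<exists>i j. i \<noteq> j \<and> d\<^sup>2 - (\<Sum>i\<in>UNIV. (c i)\<^sup>2) = 2 * c i \<and> c j = c i"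
proof -
  obtain p where p: "\<And>i. c i \<le> c p"
    by (rule ex_maximizer[of UNIV c]) auto
  have ne: "UNIV - {p} \<noteq> {}" "UNIV - {p, q} \<noteq> {}" for q
    using card(1) card_mono[of "{p}" UNIV] card_mono[of "{p, q}" UNIV]
      card_insert_le_m1[of 2 "{q}" p] by auto
  obtain q where q: "q \<noteq> p" "\<And>i. i \<noteq> p \<Longrightarrow> c i \<le> c q"
    by (rule ex_maximizer[of "UNIV - {p}" c]) (use ne(1) in auto)
  obtain s where s: "s \<noteq> p" "s \<noteq> q" "\<And>i. i \<noteq> p \<Longrightarrow> i \<noteq> q \<Longrightarrow> c i \<le> c s"
    by (rule ex_maximizer[of "UNIV - {p, q}" c]) (use ne(2)[of q] in auto)
  have "(\<Sum>i\<in>UNIV. c i) = c p + c q + (\<Sum>i\<in>UNIV - {p, q}. c i)"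
    using q(1) by (simp add: sum.remove[of UNIV p] sum.remove[of "UNIV - {p}" q]
        Diff_insert2[symmetric] insert_commute)
  moreover have "(\<Sum>i\<in>UNIV - {p, q}. c i) \<le> (\<Sum>i\<in>UNIV - {p, q}. c s)"
    using s(3) by (intro sum_mono) auto
  moreover have "card (UNIV - {p, q}) \<le> 6"
    using card q(1) by (simp add: card_Diff_subset)
  then have "int (card (UNIV - {p, q})) * c s \<le> 6 * c s"
    using nonneg[of s] by (intro mult_right_mono) auto
  ultimately have sum_le: "(\<Sum>i\<in>UNIV. c i) \<le> c p + c q + 6 * c s"
    by simp
  have d: "c p + c q + c s \<le> d"
    using q(1) s by (intro reduced) auto
  have order: "0 \<le> c s" "c s \<le> c q" "c q \<le> c p"
    using nonneg[of s] p q s by auto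
  have key: "3 * d - c p - c q - 6 * c s \<le> 2"
    using sum_le degree by linarith
  show ?thesis
  proof (cases "c s = 2")
    case True
    then have vals: "c p = 2" "c q = 2" "d = 6"
      using key order d by linarith+
    \<comment> \<open>The deficits \<open>2 - c i\<close> are non-negative with sum \<open>2 r - 16 \<le> 0\<close>, so all vanish.\<close>
    have "(\<Sum>i\<in>UNIV. 2 - c i) = 2 * int CARD('n) - 16"
      using degree vals by (simp add: sum_subtractf)
    then have "(\<Sum>i\<in>UNIV. 2 - c i) \<le> 0"
      using card by linarith
    moreover have "\<And>i. 0 \<le> 2 - c i"
      using p vals by simp
    ultimately have "\<forall>i. c i = 2"
      by (smt (verit) UNIV_I finite sum_nonneg sum_nonneg_eq_0_iff)
    moreover from this have "CARD('n) = 8"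
      using degree vals by simp
    ultimately show ?thesis
      using vals q(1) by (intro exI[of _ p] exI[of _ q]) simp
  next
    case False
    then have le1: "c p \<le> 1"
      using key order d by linarith
    \<comment> \<open>All coefficients are 0 or 1 in the remaining cases, so \<open>D\<^sup>2 = d\<^sup>2 - 3 d + 2\<close>.\<close>
    have "(c i)\<^sup>2 = c i" for i
    proof -
      have "c i = 0 \<or> c i = 1"
        using nonneg[of i] p[of i] le1 by linarith
      then show ?thesis
        by auto
    qed
    then have sq: "(\<Sum>i\<in>UNIV. (c i)\<^sup>2) = 3 * d - 2"
      using degree by simp
    show ?thesis
    proof (cases "c s = 1")
      case True
      then have "c p = 1" "c q = 1" "d = 3"
        using key order d le1 by linarith+
      then show ?thesis
        using q(1) sq by (intro exI[of _ p] exI[of _ q]) simp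
    next
      case c0: False
      then have "c s = 0"
        using order le1 by linarith
      then have "c q = 0" "d = c p"
        using key order d le1 sum_le degree nonneg[of q] by linarith+
      moreover have "(\<Sum>i\<in>UNIV. c i) \<ge> c p"
        using nonneg by (intro member_le_sum) auto
      ultimately have "d = 1"
        using degree le1 sum_le \<open>c s = 0\<close> by linarith
      then show ?thesis
        using s sq \<open>c s = 0\<close> \<open>c q = 0\<close> by (intro exI[of _ s] exI[of _ q]) simp
    qed
  qed
qed

text \<open>
  Descent on the coefficient \<open>d = D \<cdot> h\<close>. It is non-negative on nef classes because \<open>h\<close> is the sum
  of the lines \<open>h - e\<^sub>i - e\<^sub>j\<close>, \<open>e\<^sub>i\<close> and \<open>e\<^sub>j\<close>; a reflection in a Cremona root \<open>\<alpha>\<close> with \<open>D \<cdot> \<alpha> < 0\<close> lowers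
  it, and preserves both hypotheses and conclusion. A class that admits no such root is reduced, and
  two exceptional classes serve as \<open>n\<close> and \<open>n'\<close>. They are required to be skew so that they cannot
  be the two summands of a decomposition \<open>D = l + l'\<close> with \<open>l \<cdot> l' \<ge> 1\<close>.
\<close>

lemma nef_degree_two_splits:
  fixes D :: "'n::finite pic"
  assumes card: "3 \<le> CARD('n)" "CARD('n) \<le> 8"
    and "nef D" "D \<cdot> canonical = - 2"
  shows "\<exists>n\<in>lines. \<exists>n'\<in>lines. n \<cdot> n' = 0 \<and> D - n \<in> lines \<and> D - n' \<in> lines"
  using assms(3,4)
proof (induction "nat (fst D)" arbitrary: D rule: less_induct)
  case less
  show ?case
  proof (cases "\<exists>i j k. i \<noteq> j \<and> i \<noteq> k \<and> j \<noteq> k \<and> D \<cdot> (hyp - exc i - exc j - exc k) < 0")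
    case True
    then obtain i j k where ijk: "i \<noteq> j" "i \<noteq> k" "j \<noteq> k"
      and neg: "D \<cdot> (hyp - exc i - exc j - exc k) < 0"
      by blast
    define \<alpha> :: "'n pic" where "\<alpha> = hyp - exc i - exc j - exc k"
    have root: "is_root \<alpha>"
      using ijk by (simp add: \<alpha>_def cremona_root)
    have nef: "nef (reflect \<alpha> D)"
      using root less.prems by (intro nef_reflect)
    have nonneg: "0 \<le> reflect \<alpha> D \<cdot> l" if "l \<in> lines" for l
      using nef that by (simp add: nef_def)
    have "0 \<le> fst (reflect \<alpha> D)"
      using nonneg[OF secant_line[OF ijk(1)]] nonneg[OF exc_line[of i]] nonneg[OF exc_line[of j]]
      by (simp add: isect_diff_right isect_hyp_right)
    moreover have "fst (reflect \<alpha> D) < fst D"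
      using neg by (simp add: reflect_def flip: \<alpha>_def) (simp add: \<alpha>_def hyp_def exc_def)
    ultimately have "nat (fst (reflect \<alpha> D)) < nat (fst D)"
      by simp
    from less.hyps[OF this nef] obtain n n' where n: "n \<in> lines" "n' \<in> lines" "n \<cdot> n' = 0"
      "reflect \<alpha> D - n \<in> lines" "reflect \<alpha> D - n' \<in> lines"
      using less.prems by (auto simp: reflect_degree root)
    then have "reflect \<alpha> (reflect \<alpha> D - n) \<in> lines" "reflect \<alpha> (reflect \<alpha> D - n') \<in> lines"
      by (simp_all add: reflect_line root)
    then have "D - reflect \<alpha> n \<in> lines" "D - reflect \<alpha> n' \<in> lines"
      by (simp_all add: reflect_diff reflect_reflect root)
    then show ?thesis
      using n by (metis reflect_line isect_reflect_reflect root)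
  next
    case False
    have "\<exists>i j. i \<noteq> j \<and> (fst D)\<^sup>2 - (\<Sum>i\<in>UNIV. (D \<cdot> exc i)\<^sup>2) = 2 * (D \<cdot> exc i) \<and> D \<cdot> exc j = D \<cdot> exc i"
    proof (rule reduced_degree_two[OF card])
      show "0 \<le> D \<cdot> exc i" for i
        using less.prems exc_line by (auto simp: nef_def)
      show "D \<cdot> exc i + D \<cdot> exc j + D \<cdot> exc k \<le> fst D" if "i \<noteq> j" "i \<noteq> k" "j \<noteq> k" for i j k
      proof -
        have "0 \<le> D \<cdot> (hyp - exc i - exc j - exc k)"
          using False that by (meson not_less)
        then show ?thesis
          by (simp add: isect_diff_right isect_hyp_right)
      qed
      show "3 * fst D - (\<Sum>i\<in>UNIV. D \<cdot> exc i) = 2"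
        using less.prems by (simp add: isect_canonical isect_exc_right sum_negf)
    qed
    moreover have "D \<cdot> D = (fst D)\<^sup>2 - (\<Sum>i\<in>UNIV. (D \<cdot> exc i)\<^sup>2)"
      by (simp add: isect_def[of D D] isect_exc_right power2_eq_square)
    ultimately obtain i j where ij: "i \<noteq> j" "D \<cdot> D = 2 * (D \<cdot> exc i)" "D \<cdot> exc j = D \<cdot> exc i"
      by auto
    have "D - exc k \<in> lines" if "D \<cdot> D = 2 * (D \<cdot> exc k)" for k
      using that less.prems
      by (simp add: lines_def isect_bilinear isect_exc_exc isect_commute[of "exc k" D]
          line_degree[OF exc_line])
    then show ?thesis
      using ij by (intro bexI[of _ "exc i"] bexI[of _ "exc j"])
        (simp_all add: exc_line isect_exc_exc)
  qed
qed

section \<open>Edges of the Gosset polytope\<close>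

lemma line_in_gosset: "l \<in> lines \<Longrightarrow> to_real l \<in> gosset"
  by (simp add: gosset_def hull_inc)

text \<open>
  If \<open>l \<cdot> l' \<ge> 1\<close>, then \<open>l + l'\<close> is nef and equals \<open>n + (l + l' - n)\<close> for a line \<open>n\<close> different from
  \<open>l\<close> and \<open>l'\<close> whose complement is a line too. The two segments have the same midpoint, so a face
  containing \<open>l\<close> and \<open>l'\<close> contains \<open>n\<close>. But \<open>n\<close> is not on the segment from \<open>l\<close> to \<open>l'\<close>: its
  intersection number with every point of that segment is non-negative, whereas \<open>n \<cdot> n = - 1\<close>.
\<close>

lemma edge_imp_skew:
  fixes l l' :: "'n::finite pic"
  assumes card: "3 \<le> CARD('n)" "CARD('n) \<le> 8"
    and l: "l \<in> lines" "l' \<in> lines" "l \<noteq> l'"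
    and face: "convex hull {to_real l, to_real l'} face_of gosset"
  shows "l \<cdot> l' = 0"
proof (rule ccontr)
  assume "l \<cdot> l' \<noteq> 0"
  then have pos: "1 \<le> l \<cdot> l'"
    using distinct_lines_isect_nonneg[OF card(2) l] by simp
  define D where "D = l + l'"
  have "nef D"
    unfolding nef_def
  proof
    fix m :: "'n pic"
    assume m: "m \<in> lines"
    consider "m = l" | "m = l'" | "m \<noteq> l" "m \<noteq> l'"
      by blast
    then show "0 \<le> D \<cdot> m"
    proof cases
      case 3
      then show ?thesis
        using l m distinct_lines_isect_nonneg[OF card(2), of l m]
          distinct_lines_isect_nonneg[OF card(2), of l' m]
        by (simp add: D_def isect_add_left)
    qed (use l pos in \<open>simp_all add: D_def isect_add_left line_square isect_commute[of l' l]\<close>)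
  qed
  moreover have "D \<cdot> canonical = - 2"
    using l by (simp add: D_def isect_add_left line_degree)
  ultimately obtain n1 n2 where n12: "n1 \<in> lines" "n2 \<in> lines" "n1 \<cdot> n2 = 0"
    "D - n1 \<in> lines" "D - n2 \<in> lines"
    using nef_degree_two_splits[OF card] by blast
  have "\<not> {n1, n2} \<subseteq> {l, l'}"
    using n12 l pos line_square[of n1] by (auto simp: isect_commute[of l' l] line_square)
  then obtain n where n: "n \<in> lines" "D - n \<in> lines" "n \<noteq> l" "n \<noteq> l'"
    using n12 by blast
  have nn: "0 \<le> n \<cdot> l" "0 \<le> n \<cdot> l'"
    using n l by (simp_all add: distinct_lines_isect_nonneg[OF card(2)])
  have "n \<noteq> D - n"
  proof
    assume "n = D - n"
    then have "n \<cdot> n = n \<cdot> (D - n)"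
      by simp
    also have "\<dots> = n \<cdot> l + n \<cdot> l' - n \<cdot> n"
      by (simp add: D_def isect_bilinear)
    finally show False
      using nn line_square[OF n(1)] by linarith
  qed
  then have ne: "to_real n \<noteq> to_real (D - n)"
    by (simp add: inj_eq[OF inj_to_real])
  have "to_real n + to_real (D - n) = to_real l + to_real l'"
    by (simp add: D_def flip: to_real_add)
  then have mid: "midpoint (to_real n) (to_real (D - n)) = midpoint (to_real l) (to_real l')"
    by (simp add: midpoint_def)
  have "midpoint (to_real n) (to_real (D - n)) \<in> open_segment (to_real n) (to_real (D - n))"
    using ne by simp
  moreover have "midpoint (to_real n) (to_real (D - n)) \<in> convex hull {to_real l, to_real l'}"
    unfolding mid by (simp flip: segment_convex_hull)
  ultimately have "to_real n \<in> convex hull {to_real l, to_real l'}"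
    using face n by (meson face_ofD line_in_gosset)
  then obtain u where u: "0 \<le> u" "u \<le> 1" "to_real n = (1 - u) *\<^sub>R to_real l + u *\<^sub>R to_real l'"
    by (auto simp: in_segment simp flip: segment_convex_hull)
  then have "to_real n \<cdot> to_real n =
      (1 - u) * (to_real l \<cdot> to_real n) + u * (to_real l' \<cdot> to_real n)"
    by (metis isect_add_left isect_scaleR_left)
  then have "- 1 = (1 - u) * of_int (n \<cdot> l) + u * of_int (n \<cdot> l')"
    using n by (simp add: isect_to_real line_square isect_commute[of l n] isect_commute[of l' n])
  moreover have "0 \<le> (1 - u) * of_int (n \<cdot> l) + u * of_int (n \<cdot> l')"
    using u nn by simp
  ultimately show False
    by linarith
qed

section \<open>Skew sets of lines and simplices\<close>

definition skew_sets :: "nat \<Rightarrow> 'n::finite pic set set"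
  where "skew_sets a =
    {S. S \<subseteq> lines \<and> finite S \<and> card S = a \<and> pairwise (\<lambda>l l'. l \<cdot> l' = 0) S}"

text \<open>
  The sum of a skew set is negative on the members of the set and, by the lemma that follows, on no
  other line; this recovers the set from its sum and also yields the supporting hyperplane of the
  corresponding face.
\<close>

lemma isect_skew_sum:
  assumes "S \<in> skew_sets a" "l \<in> S"
  shows "\<Sum>S \<cdot> l = - 1"
proof -
  have "\<Sum>S \<cdot> l = (\<Sum>l'\<in>S. if l' = l then - 1 else 0)"
    unfolding isect_sum_left using assms
    by (intro sum.cong) (auto simp: skew_sets_def pairwise_def line_square)
  then show ?thesis
    using assms by (simp add: skew_sets_def)
qed

lemma isect_skew_sum_nonneg:
  fixes S :: "'n::finite pic set"
  assumes "CARD('n) \<le> 8" "S \<in> skew_sets a" "l \<in> lines" "l \<notin> S"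
  shows "0 \<le> \<Sum>S \<cdot> l"
  unfolding isect_sum_left using assms
  by (intro sum_nonneg distinct_lines_isect_nonneg) (auto simp: skew_sets_def)

lemma skew_lines_eq: "skew_lines a = (\<lambda>S. \<Sum>S) ` skew_sets a"
  by (auto simp: skew_lines_def skew_sets_def)

lemma inj_on_skew_sum:
  assumes "CARD('n) \<le> 8"
  shows "inj_on (\<lambda>S. \<Sum>S) (skew_sets a :: 'n::finite pic set set)"
proof (rule inj_onI)
  have sub: "S \<subseteq> T" if "S \<in> skew_sets a" "T \<in> skew_sets a" "\<Sum>S = \<Sum>T" for S T :: "'n pic set"
  proof
    fix l assume "l \<in> S"
    moreover from this have "l \<in> lines"
      using that(1) by (auto simp: skew_sets_def)
    ultimately show "l \<in> T"
      using isect_skew_sum[OF that(1)] isect_skew_sum_nonneg[OF assms that(2)] that(3) by fastforce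
  qed
  show "S = T" if "S \<in> skew_sets a" "T \<in> skew_sets a" "\<Sum>S = \<Sum>T" for S T :: "'n pic set"
    using sub[of S T] sub[of T S] that by auto
qed

text \<open>
  Pairing a linear relation with one of its members, which are orthogonal of square \<open>-1\<close>, isolates
  the coefficient of that member.
\<close>

lemma skew_set_affine_independent:
  fixes S :: "'n::finite pic set"
  assumes "S \<in> skew_sets a"
  shows "\<not> affine_dependent (to_real ` S)"
proof
  assume "affine_dependent (to_real ` S)"
  then have "dependent (to_real ` S)"
    by (rule affine_dependent_imp_dependent)
  moreover have "finite (to_real ` S)"
    using assms by (simp add: skew_sets_def)
  ultimately obtain u v where v: "v \<in> to_real ` S" "u v \<noteq> 0"
    and 0: "(\<Sum>w\<in>to_real ` S. u w *\<^sub>R w) = 0"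
    using dependent_finite by blast
  obtain l where l: "l \<in> S" "v = to_real l"
    using v by blast
  have "0 = (\<Sum>w\<in>to_real ` S. u w *\<^sub>R w) \<cdot> v"
    by (simp add: 0)
  also have "\<dots> = (\<Sum>w\<in>to_real ` S. u w * (w \<cdot> v))"
    by (simp add: isect_sum_left isect_scaleR_left)
  also have "\<dots> = (\<Sum>w\<in>to_real ` S. if w = v then - u v else 0)"
    using assms l by (intro sum.cong)
      (auto simp: isect_to_real skew_sets_def pairwise_def line_square subset_iff inj_eq[OF inj_to_real])
  also have "\<dots> = - u v"
    using assms v by (simp add: skew_sets_def)
  finally show False
    using v by simp
qed

text \<open>
  The points of \<open>V\<close> may be infinite in number, so no smallest gap \<open>m \<bullet> v - b\<close> is available. The
  union of the open half-space with the hull of \<open>T\<close> is convex, so it contains the hull of \<open>V\<close>, and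
  it meets the hyperplane only in the hull of \<open>T\<close>.
\<close>

lemma convex_hull_exposed_face:
  fixes V :: "'a::euclidean_space set"
  assumes "T \<subseteq> V" and on: "\<And>v. v \<in> T \<Longrightarrow> m \<bullet> v = b" and off: "\<And>v. v \<in> V - T \<Longrightarrow> b < m \<bullet> v"
  shows "convex hull T face_of convex hull V"
proof -
  have T: "m \<bullet> x = b" if "x \<in> convex hull T" for x
  proof -
    have "convex hull T \<subseteq> {x. m \<bullet> x = b}"
      using on by (intro hull_minimal convex_hyperplane) auto
    then show ?thesis
      using that by auto
  qed
  let ?W = "{x. b < m \<bullet> x} \<union> convex hull T"
  have "convex ?W"
  proof (rule convexI)
    fix x y and u v :: real
    assume x: "x \<in> ?W" and y: "y \<in> ?W" and uv: "0 \<le> u" "0 \<le> v" "u + v = 1"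
    show "u *\<^sub>R x + v *\<^sub>R y \<in> ?W"
    proof (cases "(x \<in> convex hull T \<and> y \<in> convex hull T) \<or> u = 0 \<or> v = 0")
      case True
      then show ?thesis
        using x y uv convexD[OF convex_convex_hull[of T], of x y u v] by auto
    next
      case False
      then have "0 < u" "0 < v" and ge: "b \<le> m \<bullet> x" "b \<le> m \<bullet> y" "b < m \<bullet> x \<or> b < m \<bullet> y"
        using x y T uv by (auto simp: order_le_less)
      then have "0 < u * (m \<bullet> x - b) + v * (m \<bullet> y - b)"
        by (auto simp: add_pos_nonneg add_nonneg_pos)
      also have "\<dots> = m \<bullet> (u *\<^sub>R x + v *\<^sub>R y) - (u + v) * b"
        by (simp add: inner_add_right algebra_simps)
      finally show ?thesis
        using uv by simp
    qed
  qed
  then have W: "convex hull V \<subseteq> ?W"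
    using off by (intro hull_minimal) (auto intro: hull_inc)
  have "convex hull V \<inter> {x. m \<bullet> x = b} face_of convex hull V"
    using W T by (intro face_of_Int_supporting_hyperplane_ge) force+
  moreover have "convex hull V \<inter> {x. m \<bullet> x = b} = convex hull T"
    using W T hull_mono[OF assms(1), of convex] by force
  ultimately show ?thesis
    by simp
qed

text \<open>
  The supporting hyperplane is given by \<open>M = \<Sum>S - K\<close>: on a line \<open>l\<close> its value is \<open>\<Sum>S \<cdot> l + 1\<close>,
  which is \<open>0\<close> for \<open>l \<in> S\<close> and at least \<open>1\<close> otherwise.
\<close>

lemma skew_set_face:
  fixes S :: "'n::finite pic set"
  assumes card: "CARD('n) \<le> 8" and S: "S \<in> skew_sets a"
  shows "convex hull (to_real ` S) face_of gosset"
proof -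
  define M where "M = \<Sum>S - canonical"
  define m where "m = (fst (to_real M), - snd (to_real M))"
  have m: "m \<bullet> to_real l = of_int (M \<cdot> l)" for l
    by (simp add: m_def isect_to_real flip: isect_as_inner)
  have M: "M \<cdot> l = \<Sum>S \<cdot> l + 1" if "l \<in> lines" for l
    using that by (simp add: M_def isect_diff_left isect_commute[of canonical] line_degree)
  have sub: "S \<subseteq> lines"
    using S by (simp add: skew_sets_def)
  show ?thesis
    unfolding gosset_def
  proof (rule convex_hull_exposed_face)
    show "to_real ` S \<subseteq> to_real ` lines"
      using sub by blast
    show "m \<bullet> v = 0" if "v \<in> to_real ` S" for v
      using that sub by (auto simp: m M isect_skew_sum[OF S] subset_iff)
    show "0 < m \<bullet> v" if v: "v \<in> to_real ` lines - to_real ` S" for v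
    proof -
      obtain l where "l \<in> lines" "l \<notin> S" "v = to_real l"
        using v by blast
      then show ?thesis
        using isect_skew_sum_nonneg[OF card S] by (simp add: m M add_nonneg_pos)
    qed
  qed
qed

lemma extreme_points_skew_simplex:
  assumes "S \<in> skew_sets a"
  shows "{v. v extreme_point_of (convex hull (to_real ` S))} = to_real ` S"
  using extreme_point_of_convex_hull_affine_independent[OF skew_set_affine_independent[OF assms]]
  by auto

lemma skew_set_simplex:
  fixes S :: "'n::finite pic set"
  assumes "CARD('n) \<le> 8" and "1 \<le> a" and S: "S \<in> skew_sets a"
  shows "convex hull (to_real ` S) \<in> gosset_simplexes (a - 1)"
proof -
  have "card (to_real ` S) = a"
    using S by (simp add: skew_sets_def card_image inj_on_subset[OF inj_to_real])
  then have "int (a - 1) simplex convex hull (to_real ` S)"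
    using skew_set_affine_independent[OF S] \<open>1 \<le> a\<close> unfolding simplex_def by auto
  moreover have "pic_dist (to_real l) (to_real l') = sqrt 2" if "l \<in> S" "l' \<in> S" "l \<noteq> l'" for l l'
  proof -
    have "l \<cdot> l' = 0" "l' \<cdot> l = 0" "l \<cdot> l = - 1" "l' \<cdot> l' = - 1"
      using S that by (auto simp: skew_sets_def pairwise_def intro: line_square)
    then show ?thesis
      by (simp add: pic_dist_def isect_bilinear isect_to_real)
  qed
  then have "pairwise (\<lambda>v w. pic_dist v w = sqrt 2) (to_real ` S)"
    by (auto simp: pairwise_def)
  ultimately have "regular_simplex (a - 1) (convex hull (to_real ` S))"
    unfolding regular_simplex_def extreme_points_skew_simplex[OF S] by blast
  then show ?thesis
    using skew_set_face[OF assms(1) S] by (simp add: gosset_simplexes_def)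
qed

text \<open>
  Extreme points of a face are extreme points of the polytope, hence lines, and every two vertices of
  a simplex span an edge of it. Skewness of the vertices then follows from that of the endpoints of
  an edge.
\<close>

lemma simplex_face_from_skew_set:
  fixes F :: "'n::finite pic_real set"
  assumes card: "3 \<le> CARD('n)" "CARD('n) \<le> 8" and "1 \<le> a"
    and F: "F face_of gosset" "int (a - 1) simplex F"
  shows "\<exists>S\<in>skew_sets a. F = convex hull (to_real ` S)"
proof -
  obtain C where C: "\<not> affine_dependent C" "int (card C) = int (a - 1) + 1" "F = convex hull C"
    using F(2) by (auto simp: simplex_def)
  have "C \<subseteq> to_real ` lines"
  proof
    fix v assume "v \<in> C"
    then have "v extreme_point_of F"
      using C by (simp add: extreme_point_of_convex_hull_affine_independent)
    then have "v extreme_point_of gosset"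
      using F(1) extreme_point_of_face by blast
    then show "v \<in> to_real ` lines"
      unfolding gosset_def by (rule extreme_point_of_convex_hull)
  qed
  then obtain S where S: "S \<subseteq> lines" "C = to_real ` S"
    by (auto simp: subset_image_iff)
  have inj: "inj_on to_real S"
    by (rule inj_on_subset[OF inj_to_real]) simp
  have "card S = a"
    using C(2) \<open>1 \<le> a\<close> by (simp add: S(2) card_image[OF inj])
  moreover have "finite S"
    using aff_independent_finite[OF C(1)] inj by (simp add: S(2) finite_image_iff)
  moreover have "l \<cdot> l' = 0" if l: "l \<in> S" "l' \<in> S" "l \<noteq> l'" for l l'
  proof (rule edge_imp_skew[OF card])
    have "convex hull {to_real l, to_real l'} face_of F"
      unfolding C(3) face_of_convex_hull_affine_independent[OF C(1)]
      using l by (intro exI[of _ "{to_real l, to_real l'}"]) (simp add: S(2))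
    then show "convex hull {to_real l, to_real l'} face_of gosset"
      using F(1) by (rule face_of_trans)
  qed (use l S in auto)
  ultimately have "S \<in> skew_sets a"
    using S by (simp add: skew_sets_def pairwise_def)
  then show ?thesis
    using C(3) S(2) by blast
qed

lemma bij_betw_skew_sets_simplexes:
  assumes card: "3 \<le> CARD('n)" "CARD('n) \<le> 8" and "1 \<le> a"
  shows "bij_betw (\<lambda>S. convex hull (to_real ` S))
    (skew_sets a :: 'n::finite pic set set) (gosset_simplexes (a - 1))"
  unfolding bij_betw_def
proof
  show "inj_on (\<lambda>S. convex hull (to_real ` S)) (skew_sets a :: 'n pic set set)"
  proof (rule inj_onI)
    fix S T :: "'n pic set"
    assume "S \<in> skew_sets a" "T \<in> skew_sets a"
      "convex hull (to_real ` S) = convex hull (to_real ` T)"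
    then have "to_real ` S = to_real ` T"
      by (metis extreme_points_skew_simplex)
    then show "S = T"
      by (simp add: inj_image_eq_iff[OF inj_to_real])
  qed
  show "(\<lambda>S. convex hull (to_real ` S)) ` skew_sets a = (gosset_simplexes (a - 1) :: 'n pic_real set set)"
    using skew_set_simplex[OF card(2) \<open>1 \<le> a\<close>] simplex_face_from_skew_set[OF card \<open>1 \<le> a\<close>]
    by (fastforce simp: gosset_simplexes_def regular_simplex_def)
qed

theorem theorem10:
  fixes r a :: nat
  assumes "CARD('n::finite) = r"
    and "3 \<le> r" and "r \<le> 8"
    and "1 \<le> a" and "a \<le> r"
  shows "\<exists>f. bij_betw f (skew_lines a :: 'n pic set) (gosset_simplexes (a - 1) :: 'n pic_real set set)"
proof -
  have "bij_betw (\<lambda>S. \<Sum>S) (skew_sets a) (skew_lines a :: 'n pic set)"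
    using inj_on_skew_sum[where 'n = 'n] assms by (simp add: bij_betw_def skew_lines_eq)
  then show ?thesis
    using bij_betw_skew_sets_simplexes[where 'n = 'n, of a] assms
      bij_betw_inv_into bij_betw_trans by blast
qed

end
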